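(* Let $U$ be a nonempty set. For every MSO formula $\varphi$, deep validity and validity of the maximal-shallow translation coincide: $\models^d\varphi$ if and only if $\models^s\llbracket\varphi\rrbracket$.
   Context: **Syntax.** Relation symbols $R=\mathbb N$, first-order variables $V=\mathbb N$ and second-order (monadic) variables $V_2=\mathbb N$ (the two kinds of variables form separate namespaces). MSO formulas (an inductive datatype): $\varphi,\psi ::= r(x,y)\mid X(x)\mid\neg\varphi\mid\varphi\wedge\psi\mid\exists x.\varphi\mid\exists X.\varphi$ with $r\in R$, $x,y\in V$, $X\in V_2$ (no equality). **Deep semantics.** $U$ is a fixed nonempty set (the type of individuals). An interpretation $I$ over $U$ assigns to each $r\in R$ a binary relation $I(r)\subseteq U\times U$. Given $I$, $D\subseteq U$, $E\subseteq\mathcal P(U)$, $g:V\to U$, $G:V_2\to\mathcal P(U)$, truth $\langle I,D,E\rangle,g,G\models^d\varphi$ is defined recursively: $r(x,y)$ holds iff $(g(x),g(y))\in I(r)$; $X(x)$ holds iff $g(x)\in G(X)$; $\neg,\wedge$ are classical; $\exists x.\varphi$ holds iff $\langle I,D,E\rangle,g[x\leftarrow d],G\models^d\varphi$ for some $d\in D$; $\exists X.\varphi$ holds iff $\langle I,D,E\rangle,g,G\langle X\leftarrow S\rangle\models^d\varphi$ for some $S\in E$. Here $g[x\leftarrow d]$ is the assignment that maps $x$ to $d$ and agrees with $g$ elsewhere, and $G\langle X\leftarrow S\rangle$ is the assignment that maps $X$ to $S$ and agrees with $G$ elsewhere. $\models^d\varphi$ means: for all $I$, $D\subseteq U$, $E\subseteq\mathcal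 P(U)$, all $g$ with $\mathrm{Range}(g)\subseteq D$ and all $G$ with $\mathrm{Range}(G)\subseteq E$, $\langle I,D,E\rangle,g,G\models^d\varphi$. **Maximal-shallow embedding.** Let $\sigma$ be the set of all Boolean-valued functions of arguments $(I,D,E,g,G)$, where $I$ is an interpretation over $U$ (assigning to each $r\in R$ a binary relation $I(r)\subseteq U\times U$), $D\subseteq U$, $E\subseteq\mathcal P(U)$, $g:V\to U$ and $G:V_2\to\mathcal P(U)$. The shallow operations are: $r^s(x,y):=\lambda I\,D\,E\,g\,G.\ (g(x),g(y))\in I(r)$; $X^s(x):=\lambda I\,D\,E\,g\,G.\ g(x)\in G(X)$; $\neg^s a:=\lambda I\,D\,E\,g\,G.\ \neg a(I,D,E,g,G)$; $a\wedge^s b$ pointwise conjunction; $\exists^s x.a:=\lambda I\,D\,E\,g\,G.\ \exists d\in D.\ a(I,D,E,g[x\leftarrow d],G)$; $\exists^s_2X.a:=\lambda I\,D\,E\,g\,G.\ \exists S\in E.\ a(I,D,E,g,G\langle X\leftarrow S\rangle)$. The translation $\llbracket\cdot\rrbracket$ from MSO formulas to $\sigma$ maps each constructor to the corresponding shallow operation. For $a\in\sigma$, $\models^s a$ means $a(I,D,E,g,G)$ is true for all $I$, $D\subseteq U$, $E\subseteq\mathcal P(U)$, all $g$ with $\mathrm{Range}(g)\subseteq D$ and all $G$ with $\mathrm{Range}(G)\subseteq E$. *)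

theory Defs
  imports Main
begin

type_synonym rel_sym = nat
type_synonym fo_var = nat
type_synonym so_var = nat

datatype mso =
    Rel rel_sym fo_var fo_var
  | Mem so_var fo_var  \<comment> \<open>\<open>Mem X x\<close> is the atom X(x)\<close>
  | Neg mso
  | And mso mso
  | Ex fo_var mso
  | Ex2 so_var mso

text \<open>The nonempty set U of individuals is rendered as the type variable \<open>'u\<close>.\<close>

type_synonym 'u interp = "rel_sym \<Rightarrow> ('u \<times> 'u) set"
type_synonym 'u fo_assign = "fo_var \<Rightarrow> 'u"
type_synonym 'u so_assign = "so_var \<Rightarrow> 'u set"

primrec deep_holds ::
  "'u interp \<Rightarrow> 'u set \<Rightarrow> 'u set set \<Rightarrow> 'u fo_assign \<Rightarrow> 'u so_assign \<Rightarrow> mso \<Rightarrow> bool"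
where
  "deep_holds I D E g G (Rel r x y) \<longleftrightarrow> (g x, g y) \<in> I r"
| "deep_holds I D E g G (Mem X x) \<longleftrightarrow> g x \<in> G X"
| "deep_holds I D E g G (Neg \<phi>) \<longleftrightarrow> \<not> deep_holds I D E g G \<phi>"
| "deep_holds I D E g G (And \<phi> \<psi>) \<longleftrightarrow> deep_holds I D E g G \<phi> \<and> deep_holds I D E g G \<psi>"
| "deep_holds I D E g G (Ex x \<phi>) \<longleftrightarrow> (\<exists>d\<in>D. deep_holds I D E (g(x := d)) G \<phi>)"
| "deep_holds I D E g G (Ex2 X \<phi>) \<longleftrightarrow> (\<exists>S\<in>E. deep_holds I D E g (G(X := S)) \<phi>)"

text \<open>A formula does not mention U, so validity over U takes U as a type argument.\<close>

definition deep_valid :: "'u itself \<Rightarrow> mso \<Rightarrow> bool" where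
  "deep_valid _ \<phi> \<longleftrightarrow>
    (\<forall>(I :: 'u interp) D E g G. range g \<subseteq> D \<longrightarrow> range G \<subseteq> E \<longrightarrow> deep_holds I D E g G \<phi>)"

type_synonym 'u sigma =
  "'u interp \<Rightarrow> 'u set \<Rightarrow> 'u set set \<Rightarrow> 'u fo_assign \<Rightarrow> 'u so_assign \<Rightarrow> bool"

definition rel_s :: "rel_sym \<Rightarrow> fo_var \<Rightarrow> fo_var \<Rightarrow> 'u sigma" where
  "rel_s r x y = (\<lambda>I D E g G. (g x, g y) \<in> I r)"

definition mem_s :: "so_var \<Rightarrow> fo_var \<Rightarrow> 'u sigma" where
  "mem_s X x = (\<lambda>I D E g G. g x \<in> G X)"

definition neg_s :: "'u sigma \<Rightarrow> 'u sigma" where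
  "neg_s a = (\<lambda>I D E g G. \<not> a I D E g G)"

definition and_s :: "'u sigma \<Rightarrow> 'u sigma \<Rightarrow> 'u sigma" where
  "and_s a b = (\<lambda>I D E g G. a I D E g G \<and> b I D E g G)"

definition ex_s :: "fo_var \<Rightarrow> 'u sigma \<Rightarrow> 'u sigma" where
  "ex_s x a = (\<lambda>I D E g G. \<exists>d\<in>D. a I D E (g(x := d)) G)"

definition ex2_s :: "so_var \<Rightarrow> 'u sigma \<Rightarrow> 'u sigma" where
  "ex2_s X a = (\<lambda>I D E g G. \<exists>S\<in>E. a I D E g (G(X := S)))"

definition shallow_valid :: "'u sigma \<Rightarrow> bool" where
  "shallow_valid a \<longleftrightarrow>
    (\<forall>I D E g G. range g \<subseteq> D \<longrightarrow> range G \<subseteq> E \<longrightarrow> a I D E g G)"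

primrec translate :: "mso \<Rightarrow> 'u sigma" where
  "translate (Rel r x y) = rel_s r x y"
| "translate (Mem X x) = mem_s X x"
| "translate (Neg \<phi>) = neg_s (translate \<phi>)"
| "translate (And \<phi> \<psi>) = and_s (translate \<phi>) (translate \<psi>)"
| "translate (Ex x \<phi>) = ex_s x (translate \<phi>)"
| "translate (Ex2 X \<phi>) = ex2_s X (translate \<phi>)"

end

theory Submission
  imports Defs
begin

text \<open>Each shallow operation, once unfolded, is the semantic clause of its constructor, so the
  two semantics agree pointwise. Both validities quantify over the same tuples under the same range
  conditions, so this agreement gives the theorem.\<close>

lemma translate_iff_deep_holds:
  "translate \<phi> I D E g G \<longleftrightarrow> deep_holds I D E g G \<phi>"
  \<comment> \<open>The quantifier cases need the hypothesis at \<open>g(x := d)\<close> and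
    \<open>G(X := S)\<close>; \<open>I\<close>, \<open>D\<close> and \<open>E\<close> stay fixed
    throughout.\<close>
  by (induction \<phi> arbitrary: g G)
    (simp_all add: rel_s_def mem_s_def neg_s_def and_s_def ex_s_def ex2_s_def)

theorem mainTheorem6:
  fixes \<phi> :: mso
  shows "deep_valid TYPE('u) \<phi> \<longleftrightarrow> shallow_valid (translate \<phi> :: 'u sigma)"
  by (simp add: deep_valid_def shallow_valid_def translate_iff_deep_holds)

end
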